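(* Let $(D,\vec{s})$ be a data distribution derived from a finite projective plane of order $n$ (with $m=n^2+n+1$ machines) or from a finite affine plane of order $n$ (with $m=n^2+n$ machines). Then an ATAC computation using $(D,\vec{s})$ can be load balanced, i.e. the comparisons can be scheduled, each on a machine holding both of the data items compared, so that every machine has the same amount of comparison computations; and the amount of data replication is minimal, i.e. $L(D,\vec{s})=L_{\min}(m)$.
   Context: A data distribution on $m$ machines is a pair $(D,\vec{s})$, where, for some positive integer $x$ (the number of data groups, not fixed in advance), $D=(d_{ij})$ is an $m\times x$ matrix with entries in $\{0,1\}$ ($d_{ij}=1$ iff data group $j$ is stored on machine $i$), and $\vec{s}\in\mathbb{R}^x$ is a column vector with non-negative entries summing to $1$ ($s_j$ is the fraction of all data lying in data group $j$). It is an ATAC (All-to-All Comparison) data distribution if every entry of $D^TD$ is nonzero, i.e. every pair of data groups is held together by some machine. The data storage limit is $L(D,\vec{s})=\max_{1\le i\le m}(D\vec{s})_i$, and $L_{\min}(m)$ is the minimum of $L(D,\vec{s})$ over all ATAC data distributions on $m$ machines (over all $x$). A finite projective plane of order $n$ is a set of $n^2+n+1$ points and $n^2+n+1$ lines with an incidence relation such that: every pair of distinct points has exactly one line passing through both; every pair of distinct lines intersects in exactly one point; every line contains $n+1$ points; every point is on $n+1$ lines. A finite affine plane of order $n$ is a set of $n^2$ points and $n^2+n$ lines with an incidence relation such that: every pair of distinct points has exactly one line passing through both; every line contains $n$ points; every point is on $n+1$ lines. The data distribution derived from such a plane with $v$ points is $(D,\vec{s})$, where $D$ is the zero-one incidence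 matrix (rows indexed by lines, columns by points, entry $1$ iff the line contains the point) and $\vec{s}=(\tfrac1v,\dots,\tfrac1v)^T\in\mathbb{R}^v$. Lines are machines and points are data groups, all of equal size: machine $i$ holds all items of every data group $j$ with $d_{ij}=1$ and no others. In an ATAC computation every data item is compared with every other data item (in the same or in a different data group), each comparison being scheduled on a machine that holds both items. All machines are assumed equally capable and all comparisons are assumed to take approximately the same time. The data set is assumed to be very large, and rounding of the number of items in each data group to an integer is regarded as negligible. A data distribution is called load balanced if every machine has the same amount of comparison computations. (A separate, weaker notion, "effectively load balanced", means that no machine is scheduled more than $1$ computation more than any other machine; formally, exact load balance is only possible if the number of computations is divisible by the number of machines.) *)

theory Defs
  imports Complex_Main "Jordan_Normal_Form.Matrix"
begin

text \<open>Machines are the row indices and data groups the column indices of a matrix.\<close>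

definition data_distribution :: "nat \<Rightarrow> real mat \<Rightarrow> real vec \<Rightarrow> bool" where
  "data_distribution m D s \<longleftrightarrow>
     (\<exists>x>0. D \<in> carrier_mat m x \<and> s \<in> carrier_vec x \<and> elements_mat D \<subseteq> {0, 1} \<and>
        (\<forall>j<x. 0 \<le> s $ j) \<and> (\<Sum>j<x. s $ j) = 1)"

definition ATAC_distribution :: "nat \<Rightarrow> real mat \<Rightarrow> real vec \<Rightarrow> bool" where
  "ATAC_distribution m D s \<longleftrightarrow> data_distribution m D s \<and>
     (\<forall>j<dim_col D. \<forall>k<dim_col D. (transpose_mat D * D) $$ (j, k) \<noteq> 0)"

definition storage_limit :: "real mat \<Rightarrow> real vec \<Rightarrow> real" where
  "storage_limit D s = Max ((\<lambda>i. (D *\<^sub>v s) $ i) ` {..<dim_row D})"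

text \<open>The infimum ranges over nonnegative values, so if \<open>(D, s)\<close> is an ATAC distribution
  with \<open>storage_limit D s = L_min m\<close>, then the infimum is an attained minimum.\<close>

definition L_min :: "nat \<Rightarrow> real" where
  "L_min m = Inf {storage_limit D s | D s. ATAC_distribution m D s}"

definition finite_projective_plane ::
  "nat \<Rightarrow> 'p set \<Rightarrow> 'l set \<Rightarrow> ('p \<Rightarrow> 'l \<Rightarrow> bool) \<Rightarrow> bool" where
  "finite_projective_plane n P L I \<longleftrightarrow>
     finite P \<and> card P = n\<^sup>2 + n + 1 \<and> finite L \<and> card L = n\<^sup>2 + n + 1 \<and>
     (\<forall>p\<in>P. \<forall>q\<in>P. p \<noteq> q \<longrightarrow> (\<exists>!l. l \<in> L \<and> I p l \<and> I q l)) \<and>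
     (\<forall>k\<in>L. \<forall>l\<in>L. k \<noteq> l \<longrightarrow> (\<exists>!p. p \<in> P \<and> I p k \<and> I p l)) \<and>
     (\<forall>l\<in>L. card {p\<in>P. I p l} = n + 1) \<and>
     (\<forall>p\<in>P. card {l\<in>L. I p l} = n + 1)"

text \<open>Order 0 is excluded for affine planes: without points there is no vector of
  group sizes \<open>1 / v\<close>.\<close>

definition finite_affine_plane ::
  "nat \<Rightarrow> 'p set \<Rightarrow> 'l set \<Rightarrow> ('p \<Rightarrow> 'l \<Rightarrow> bool) \<Rightarrow> bool" where
  "finite_affine_plane n P L I \<longleftrightarrow>
     0 < n \<and> finite P \<and> card P = n\<^sup>2 \<and> finite L \<and> card L = n\<^sup>2 + n \<and>
     (\<forall>p\<in>P. \<forall>q\<in>P. p \<noteq> q \<longrightarrow> (\<exists>!l. l \<in> L \<and> I p l \<and> I q l)) \<and>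
     (\<forall>l\<in>L. card {p\<in>P. I p l} = n) \<and>
     (\<forall>p\<in>P. card {l\<in>L. I p l} = n + 1)"

definition incidence_mat :: "('p \<Rightarrow> 'l \<Rightarrow> bool) \<Rightarrow> 'l list \<Rightarrow> 'p list \<Rightarrow> real mat" where
  "incidence_mat I ls ps =
     mat (length ls) (length ps) (\<lambda>(i, j). if I (ps ! j) (ls ! i) then 1 else 0)"

text \<open>Indexing rows by lines and columns by points requires enumerating both; any
  enumeration is allowed.\<close>

definition derived_distribution ::
  "'p set \<Rightarrow> 'l set \<Rightarrow> ('p \<Rightarrow> 'l \<Rightarrow> bool) \<Rightarrow> real mat \<Rightarrow> real vec \<Rightarrow> bool" where
  "derived_distribution P L I D s \<longleftrightarrow>
     (\<exists>ls ps. distinct ls \<and> set ls = L \<and> distinct ps \<and> set ps = P \<and>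
        D = incidence_mat I ls ps \<and> s = vec (card P) (\<lambda>_. 1 / real (card P)))"

text \<open>A data set \<open>X\<close> of items whose division \<open>g\<close> into data groups has exactly the
  proportions prescribed by \<open>s\<close>.\<close>

definition grouped_data :: "real vec \<Rightarrow> 'd set \<Rightarrow> ('d \<Rightarrow> nat) \<Rightarrow> bool" where
  "grouped_data s X g \<longleftrightarrow> finite X \<and> g ` X \<subseteq> {..<dim_vec s} \<and>
     (\<forall>j<dim_vec s. real (card {a\<in>X. g a = j}) = s $ j * real (card X))"

definition comparisons :: "'d set \<Rightarrow> 'd set set" where
  "comparisons X = {c. c \<subseteq> X \<and> card c = 2}"

definition ATAC_schedule ::
  "real mat \<Rightarrow> 'd set \<Rightarrow> ('d \<Rightarrow> nat) \<Rightarrow> ('d set \<Rightarrow> nat) \<Rightarrow> bool" where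
  "ATAC_schedule D X g \<sigma> \<longleftrightarrow>
     (\<forall>c\<in>comparisons X. \<sigma> c < dim_row D \<and> (\<forall>a\<in>c. D $$ (\<sigma> c, g a) = 1))"

definition machine_load :: "'d set \<Rightarrow> ('d set \<Rightarrow> nat) \<Rightarrow> nat \<Rightarrow> nat" where
  "machine_load X \<sigma> i = card {c \<in> comparisons X. \<sigma> c = i}"

definition load_balanced :: "nat \<Rightarrow> 'd set \<Rightarrow> ('d set \<Rightarrow> nat) \<Rightarrow> bool" where
  "load_balanced m X \<sigma> \<longleftrightarrow> (\<forall>i<m. \<forall>k<m. machine_load X \<sigma> i = machine_load X \<sigma> k)"

end

theory Submission
  imports Defs "Jordan_Normal_Form.Determinant"
begin

text \<open>If every machine stores at most a fraction \<open>\<Lambda>\<close>, then the \<open>r\<^sub>j\<close> machines holding group \<open>j\<close>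
  together hold all data, so \<open>r\<^sub>j \<Lambda> \<ge> 1\<close>. When \<open>\<Lambda> < (n + 1) / m\<close> and \<open>m \<ge> n (n + 1)\<close>, this forces
  \<open>r\<^sub>j \<ge> n + 1\<close> for all \<open>j\<close>, and the total storage \<open>\<Sum>\<^sub>j r\<^sub>j s\<^sub>j \<le> m \<Lambda>\<close> gives the contradiction
  \<open>n + 1 \<le> m \<Lambda>\<close>.

  For load balance, a comparison of items in different groups must go to the line through the two
  points, and this puts the same load on every line. The comparisons inside a group are spread over
  lines through its point. In the affine case, divisibility of the number of comparisons by the
  number of machines shows that each group can spread them equally over its \<open>n + 1\<close> lines. In the
  projective case the incidence matrix is nonsingular, so a nonzero term of the Leibniz formula
  matches the points bijectively to lines through them, and each line takes all the
  comparisons inside its point.\<close>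

section \<open>The lower bound for the storage limit\<close>

text \<open>Here \<open>n\<close> is any number with n(n+1) \<le> m, so that one bound serves m =
  n(n+1) and m = n(n+1) + 1 alike; no plane on m machines is presupposed.\<close>

lemma storage_limit_lower_bound:
  assumes A: "ATAC_distribution m D s" and m: "0 < m" "n * (n + 1) \<le> m"
  shows "real (n + 1) / real m \<le> storage_limit D s"
proof (rule ccontr)
  assume neg: "\<not> ?thesis"
  obtain x where x: "x > 0" and D: "D \<in> carrier_mat m x" and s: "s \<in> carrier_vec x"
    and el: "elements_mat D \<subseteq> {0, 1}" and s0: "\<And>j. j < x \<Longrightarrow> 0 \<le> s $ j"
    and s1: "(\<Sum>j<x. s $ j) = 1"
    using A unfolding ATAC_distribution_def data_distribution_def by auto
  have D01: "D $$ (i, j) = 0 \<or> D $$ (i, j) = 1" if "i < m" "j < x" for i j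
    using elements_matI[OF D that refl] el by auto
  define \<Lambda> where "\<Lambda> = storage_limit D s"
  define r where "r j = card {i. i < m \<and> D $$ (i, j) = 1}" for j
  have r: "real (r j) = (\<Sum>i<m. D $$ (i, j))" if "j < x" for j
  proof -
    have "(\<Sum>i<m. D $$ (i, j)) = (\<Sum>i<m. of_bool (D $$ (i, j) = 1))"
      using D01 that by (intro sum.cong) force+
    also have "\<dots> = real (r j)"
      by (simp add: sum_of_bool_eq r_def Int_def)
    finally show ?thesis ..
  qed
  have stored: "(\<Sum>k<x. D $$ (i, k) * s $ k) \<le> \<Lambda>" if "i < m" for i
  proof -
    have "(D *\<^sub>v s) $ i = (\<Sum>k<x. D $$ (i, k) * s $ k)"
      using D s that by (simp add: scalar_prod_def lessThan_atLeast0)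
    moreover have "(D *\<^sub>v s) $ i \<le> \<Lambda>"
      unfolding \<Lambda>_def storage_limit_def using D that by (intro Max_ge) auto
    ultimately show ?thesis by simp
  qed
  have meet: "1 \<le> (\<Sum>i<m. D $$ (i, j) * D $$ (i, k))" if "j < x" "k < x" for j k
  proof -
    have "(transpose_mat D * D) $$ (j, k) = (\<Sum>i<m. D $$ (i, j) * D $$ (i, k))"
      using D that by (simp add: scalar_prod_def lessThan_atLeast0)
    moreover have "(transpose_mat D * D) $$ (j, k) \<noteq> 0"
      using A D that unfolding ATAC_distribution_def by auto
    ultimately obtain i where i: "i < m" "D $$ (i, j) * D $$ (i, k) \<noteq> 0"
      by (metis (mono_tags, lifting) lessThan_iff sum.neutral)
    then have "1 = D $$ (i, j) * D $$ (i, k)"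
      using D01[of i j] D01[of i k] that by auto
    also have "\<dots> \<le> (\<Sum>i<m. D $$ (i, j) * D $$ (i, k))"
    proof (rule member_le_sum)
      fix i' assume "i' \<in> {..<m} - {i}"
      then show "0 \<le> D $$ (i', j) * D $$ (i', k)"
        using D01[of i' j] D01[of i' k] that by auto
    qed (use i in auto)
    finally show ?thesis .
  qed
  have cover: "1 \<le> real (r j) * \<Lambda>" if j: "j < x" for j
  proof -
    \<comment> \<open>Each group k shares at least one machine with j, and the weights s_k sum to 1.
      Exchanging the sums collects, machine by machine, the data stored on the holders of j.\<close>
    have "1 \<le> (\<Sum>k<x. s $ k * (\<Sum>i<m. D $$ (i, j) * D $$ (i, k)))"
      unfolding s1[symmetric]
      using mult_left_mono[OF meet[OF j] s0] by (intro sum_mono) simp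
    also have "\<dots> = (\<Sum>i<m. D $$ (i, j) * (\<Sum>k<x. D $$ (i, k) * s $ k))"
      unfolding sum_distrib_left by (subst sum.swap) (simp add: algebra_simps)
    also have "\<dots> \<le> (\<Sum>i<m. D $$ (i, j) * \<Lambda>)"
      using stored D01[OF _ j] by (intro sum_mono) force
    also have "\<dots> = real (r j) * \<Lambda>"
      using r[OF j] by (simp add: sum_distrib_right)
    finally show ?thesis .
  qed
  have \<Lambda>_lt: "\<Lambda> * real m < real (n + 1)"
    using neg m by (simp add: \<Lambda>_def field_simps)
  have "0 < real (r 0) * \<Lambda>"
    using cover[OF x] by linarith
  then have \<Lambda>_pos: "\<Lambda> > 0"
    by (simp add: zero_less_mult_iff)
  have "n + 1 \<le> r j" if "j < x" for j
  proof (rule ccontr)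
    assume "\<not> n + 1 \<le> r j"
    then have "r j \<le> n" by simp
    then have "1 \<le> real n * \<Lambda>"
      using cover[OF that] \<Lambda>_pos by (smt (verit) mult_right_mono of_nat_mono)
    \<comment> \<open>Multiplying 1 \<le> n \<Lambda> by n+1 brings in n(n+1) \<le> m and
      contradicts \<open>\<Lambda>_lt\<close>.\<close>
    have "real (n + 1) \<le> real n * real (n + 1) * \<Lambda>"
      using \<open>1 \<le> real n * \<Lambda>\<close> mult_left_mono[of 1 "real n * \<Lambda>" "real (n + 1)"]
      by (simp add: algebra_simps)
    also have "\<dots> \<le> real m * \<Lambda>"
      using m(2) \<Lambda>_pos by (intro mult_right_mono) (metis of_nat_le_iff of_nat_mult, simp)
    finally show False using \<Lambda>_lt by (simp add: mult.commute)
  qed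
  \<comment> \<open>Total storage is counted in two ways: by groups it is the s-weighted mean of the
    replication numbers, by machines it is at most m \<Lambda>.\<close>
  then have "(\<Sum>j<x. real (n + 1) * s $ j) \<le> (\<Sum>j<x. real (r j) * s $ j)"
    using s0 by (intro sum_mono mult_right_mono of_nat_mono) auto
  also have "\<dots> = (\<Sum>i<m. \<Sum>j<x. D $$ (i, j) * s $ j)"
    by (subst sum.swap) (simp add: r sum_distrib_right)
  also have "\<dots> \<le> (\<Sum>i<m. \<Lambda>)"
    using stored by (intro sum_mono) auto
  finally show False
    using \<Lambda>_lt unfolding sum_distrib_left[symmetric] s1 by (simp add: mult.commute)
qed

section \<open>Comparisons\<close>

lemma finite_comparisons: "finite X \<Longrightarrow> finite (comparisons X)"
  by (simp add: comparisons_def)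

lemma card_comparisons: "finite X \<Longrightarrow> card (comparisons X) = card X choose 2"
  by (simp add: comparisons_def n_subsets)

definition intra_comparisons :: "'d set \<Rightarrow> ('d \<Rightarrow> nat) \<Rightarrow> nat \<Rightarrow> 'd set set" where
  "intra_comparisons X g j = comparisons {a \<in> X. g a = j}"

text \<open>Injectivity of \<open>g\<close> on a pair says that its two items lie in different
  groups.\<close>

definition cross_comparisons :: "'d set \<Rightarrow> ('d \<Rightarrow> nat) \<Rightarrow> 'd set set" where
  "cross_comparisons X g = {c \<in> comparisons X. inj_on g c}"

lemma comparisons_cases:
  assumes "c \<in> comparisons X"
  obtains a b where "c = {a, b}" "a \<noteq> b" "a \<in> X" "b \<in> X"
proof -
  have "c \<subseteq> X" "card c = 2"
    using assms by (auto simp: comparisons_def)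
  then show ?thesis
    using that unfolding card_2_iff by blast
qed

lemma image_intra_comparison: "c \<in> intra_comparisons X g j \<Longrightarrow> g ` c = {j}"
  by (auto simp: intra_comparisons_def elim!: comparisons_cases)

lemma intra_comparisons_disjoint:
  "j \<noteq> k \<Longrightarrow> intra_comparisons X g j \<inter> intra_comparisons X g k = {}"
  by (metis disjoint_iff image_intra_comparison singleton_inject)

lemma cross_intra_disjoint: "cross_comparisons X g \<inter> intra_comparisons X g j = {}"
  by (auto simp: intra_comparisons_def cross_comparisons_def elim!: comparisons_cases)

text \<open>The index set \<open>J\<close> is left free because the split is used both for the whole
  data set and for the items held by a single machine.\<close>

lemma comparisons_split:
  assumes "g ` X \<subseteq> J"
  shows "comparisons X = cross_comparisons X g \<union> (\<Union>j\<in>J. intra_comparisons X g j)"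
proof (intro equalityI subsetI)
  fix c assume c: "c \<in> comparisons X"
  then obtain a b where ab: "c = {a, b}" "a \<noteq> b" "a \<in> X" "b \<in> X"
    by (rule comparisons_cases)
  show "c \<in> cross_comparisons X g \<union> (\<Union>j\<in>J. intra_comparisons X g j)"
  proof (cases "g a = g b")
    case True
    then have "c \<in> intra_comparisons X g (g a)"
      using ab by (simp add: intra_comparisons_def comparisons_def)
    then show ?thesis using assms ab by auto
  next
    case False
    then show ?thesis using ab c by (simp add: cross_comparisons_def)
  qed
qed (auto simp: intra_comparisons_def cross_comparisons_def comparisons_def)

text \<open>A bijection from \<open>A\<close> onto \<open>R\<close> \<times> {0, ..., q-1} followed
  by the first projection has all fibres of size q.\<close>

lemma exists_equipartition:
  assumes "finite A" "finite R" "card A = card R * q"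
  shows "\<exists>h. h ` A \<subseteq> R \<and> (\<forall>y\<in>R. card {a \<in> A. h a = y} = q)"
proof -
  have "card A = card (R \<times> {..<q})"
    using assms by (simp add: card_cartesian_product)
  then obtain f where f: "bij_betw f A (R \<times> {..<q})"
    using assms by (metis bij_betw_iff_card finite_SigmaI finite_lessThan)
  have "card {a \<in> A. fst (f a) = y} = q" if "y \<in> R" for y
  proof -
    have "bij_betw f {a \<in> A. fst (f a) = y} ({y} \<times> {..<q})"
    proof (rule bij_betw_subset[OF f])
      have "f ` {a \<in> A. fst (f a) = y} = {z \<in> f ` A. fst z = y}" by auto
      then show "f ` {a \<in> A. fst (f a) = y} = {y} \<times> {..<q}"
        using bij_betw_imp_surj_on[OF f] that by auto
    qed simp
    then show ?thesis
      using bij_betw_same_card by (fastforce simp: card_cartesian_product)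
  qed
  moreover have "(fst \<circ> f) ` A \<subseteq> R"
    using bij_betwE[OF f] by (auto simp: mem_Times_iff)
  ultimately show ?thesis by (intro exI[of _ "fst \<circ> f"]) auto
qed

section \<open>Block designs\<close>

text \<open>A 2-(v, \<kappa>, 1) design on index sets, the common abstraction of both kinds of
  planes: blocks are lines or machines, points are data groups.\<close>

locale block_design =
  fixes B :: "nat \<Rightarrow> nat \<Rightarrow> bool" and m v \<kappa> r :: nat
  assumes joined: "\<lbrakk>j < v; k < v; j \<noteq> k\<rbrakk> \<Longrightarrow> \<exists>!i. i < m \<and> B i j \<and> B i k"
    and block_size: "i < m \<Longrightarrow> card {j. j < v \<and> B i j} = \<kappa>"
    and replication: "j < v \<Longrightarrow> card {i. i < m \<and> B i j} = r"
begin

text \<open>The incidence matrix A satisfies A^T A = (r-1) Id + J with J the all-ones matrix, so its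
  kernel is trivial. The case r = v = 1 is the degenerate projective plane of order 0.\<close>

lemma exists_matching:
  assumes mv: "m = v" and r: "r > 1 \<or> r = 1 \<and> v = 1"
  shows "\<exists>f. bij_betw f {..<v} {..<m} \<and> (\<forall>j<v. B (f j) j)"
proof -
  define A where "A = mat v v (\<lambda>(i, j). of_bool (B i j) :: real)"
  have A: "A \<in> carrier_mat v v" by (simp add: A_def)
  have "det A \<noteq> 0"
  proof
    assume "det A = 0"
    then obtain x where x: "x \<in> carrier_vec v" "x \<noteq> 0\<^sub>v v" "A *\<^sub>v x = 0\<^sub>v v"
      using det_0_iff_vec_prod_zero[OF A] by blast
    have Ax: "(\<Sum>j<v. of_bool (B i j) * x $ j) = 0" if "i < v" for i
    proof -
      have "(A *\<^sub>v x) $ i = (\<Sum>j<v. of_bool (B i j) * x $ j)"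
        using x(1) that by (simp add: A_def scalar_prod_def lessThan_atLeast0)
      then show ?thesis using x(3) that by simp
    qed
    define S where "S = (\<Sum>j<v. x $ j)"
    \<comment> \<open>These are the entries of A^T A: r blocks pass through a point and exactly one
      through two points.\<close>
    have common: "(\<Sum>i<v. of_bool (B i p) * of_bool (B i j) :: real) = (if j = p then real r else 1)"
      if "p < v" "j < v" for p j
    proof -
      have "(\<Sum>i<v. of_bool (B i p) * of_bool (B i j) :: real)
          = real (card {i. i < m \<and> B i p \<and> B i j})"
        unfolding of_bool_conj[symmetric] by (simp add: sum_of_bool_eq Int_def mv)
      also have "\<dots> = (if j = p then real r else 1)"
      proof (cases "j = p")
        case False
        then have "\<exists>!i. i < m \<and> B i p \<and> B i j"
          using joined[of p j] that by simp
        then obtain i where "{i. i < m \<and> B i p \<and> B i j} = {i}"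
          by blast
        then show ?thesis using False by simp
      qed (use replication that in simp)
      finally show ?thesis .
    qed
    \<comment> \<open>Row p of A^T A x = 0. Summing these rows over all p then forces S = 0.\<close>
    have point: "(real r - 1) * x $ p + S = 0" if p: "p < v" for p
    proof -
      have "0 = (\<Sum>i<v. of_bool (B i p) * (\<Sum>j<v. of_bool (B i j) * x $ j))"
        by (rule sum.neutral[symmetric]) (use Ax in auto)
      also have "\<dots> = (\<Sum>j<v. \<Sum>i<v. of_bool (B i p) * of_bool (B i j) * x $ j)"
        unfolding sum_distrib_left by (subst sum.swap) (simp add: mult.assoc)
      also have "\<dots> = (\<Sum>j<v. (if j = p then real r else 1) * x $ j)"
        by (intro sum.cong refl) (simp only: sum_distrib_right[symmetric] common[OF p] lessThan_iff)
      also have "\<dots> = (\<Sum>j<v. (if j = p then (real r - 1) * x $ p else 0) + x $ j)"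
        by (intro sum.cong) (auto simp: algebra_simps)
      also have "\<dots> = (real r - 1) * x $ p + S"
        using p by (simp add: sum.distrib S_def)
      finally show ?thesis by simp
    qed
    have "(\<Sum>p<v. (real r - 1) * x $ p) = (real r - 1) * S"
      by (simp only: S_def sum_distrib_left)
    then have "(\<Sum>p<v. (real r - 1) * x $ p + S) = (real r - 1 + real v) * S"
      unfolding sum.distrib by (simp add: distrib_right)
    then have "(real r - 1 + real v) * S = 0"
      using point by simp
    then have S0: "S = 0" using r by auto
    have "x $ p = 0" if "p < v" for p
      using r
    proof
      assume "1 < r"
      then show ?thesis using point[OF that] S0 by simp
    next
      assume "r = 1 \<and> v = 1"
      then show ?thesis using that S0 by (simp add: S_def)
    qed
    then have "x = 0\<^sub>v v" using x(1) by (intro eq_vecI) auto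
    with x(2) show False by simp
  qed
  \<comment> \<open>A nonzero term of the Leibniz formula has only nonzero factors, so its
    permutation sends every block to a point on it.\<close>
  then have "(\<Sum>p\<in>{p. p permutes {0..<v}}. signof p * (\<Prod>i = 0..<v. A $$ (i, p i))) \<noteq> 0"
    by (simp add: det_def'[OF A])
  then obtain p where "p \<in> {p. p permutes {0..<v}}"
    and "signof p * (\<Prod>i = 0..<v. A $$ (i, p i)) \<noteq> 0"
    by (rule sum.not_neutral_contains_not_neutral)
  then have p: "p permutes {0..<v}" and "(\<Prod>i = 0..<v. A $$ (i, p i)) \<noteq> 0"
    by auto
  then have "A $$ (i, p i) \<noteq> 0" if "i < v" for i
    using that by auto
  then have Bp: "B i (p i)" if "i < v" for i
    using that permutes_in_image[OF p, of i] by (fastforce simp: A_def)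
  \<comment> \<open>The permutation goes from blocks to points; the matching needs the opposite
    direction.\<close>
  have bij: "bij_betw (inv_into UNIV p) {..<v} {..<m}"
    using permutes_imp_bij[OF permutes_inv[OF p]] by (simp add: mv lessThan_atLeast0)
  moreover have "B (inv_into UNIV p j) j" if "j < v" for j
  proof -
    have "inv_into UNIV p j < v" using bij that mv by (auto simp: bij_betw_def)
    then show ?thesis using Bp[of "inv_into UNIV p j"] permutes_inverses(1)[OF p] by simp
  qed
  ultimately show ?thesis by blast
qed

end

section \<open>Balanced schedules for groups of equal size\<close>

locale grouped_design = block_design B m v \<kappa> r
  for B :: "nat \<Rightarrow> nat \<Rightarrow> bool" and m v \<kappa> r :: nat +
  fixes X :: "'d set" and g :: "'d \<Rightarrow> nat" and t :: nat
  assumes finite_X: "finite X" and groups: "g ` X \<subseteq> {..<v}"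
    and group_size: "j < v \<Longrightarrow> card {a \<in> X. g a = j} = t"
begin

lemma finite_cross: "finite (cross_comparisons X g)"
  by (simp add: cross_comparisons_def finite_comparisons finite_X)

lemma finite_intra: "finite (intra_comparisons X g j)"
  by (simp add: intra_comparisons_def finite_comparisons finite_X)

lemma card_intra: "j < v \<Longrightarrow> card (intra_comparisons X g j) = t choose 2"
  by (simp add: intra_comparisons_def card_comparisons finite_X group_size)

lemma card_Union_intra:
  assumes "J \<subseteq> {..<v}"
  shows "card (\<Union>j\<in>J. intra_comparisons X g j) = card J * (t choose 2)"
proof -
  have "card (\<Union>j\<in>J. intra_comparisons X g j) = (\<Sum>j\<in>J. card (intra_comparisons X g j))"
    using finite_subset[OF assms]
    by (intro card_UN_disjoint) (simp_all add: finite_intra intra_comparisons_disjoint)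
  also have "\<dots> = (\<Sum>j\<in>J. t choose 2)"
    using assms by (intro sum.cong) (auto simp: card_intra)
  finally show ?thesis by simp
qed

lemma card_block_items:
  assumes "i < m"
  shows "card {a \<in> X. B i (g a)} = \<kappa> * t"
proof -
  have "{a \<in> X. B i (g a)} = (\<Union>j\<in>{j. j < v \<and> B i j}. {a \<in> X. g a = j})"
    using groups by auto
  also have "card \<dots> = (\<Sum>j\<in>{j. j < v \<and> B i j}. card {a \<in> X. g a = j})"
    by (intro card_UN_disjoint) (auto simp: finite_X)
  also have "\<dots> = (\<Sum>j\<in>{j. j < v \<and> B i j}. t)"
    by (intro sum.cong) (auto simp: group_size)
  finally show ?thesis using block_size[OF assms] by simp
qed

text \<open>The pairs among the \<kappa>t items of a block, less those inside one of its \<kappa>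
  points. The latter are among the former, so the subtraction does not truncate.\<close>

definition cross_load :: nat where
  "cross_load = (\<kappa> * t choose 2) - \<kappa> * (t choose 2)"

text \<open>Only one block contains both points of a cross comparison, so the schedule is forced.
  The load of a block counts its pairs of items from different groups, which depends on \<kappa> and
  t alone.\<close>

lemma cross_schedule:
  "\<exists>\<rho>. (\<forall>c\<in>cross_comparisons X g. \<rho> c < m \<and> (\<forall>a\<in>c. B (\<rho> c) (g a))) \<and>
       (\<forall>i<m. card {c \<in> cross_comparisons X g. \<rho> c = i} = cross_load)"
proof -
  have ex1: "\<exists>!i. i < m \<and> (\<forall>a\<in>c. B i (g a))" if "c \<in> cross_comparisons X g" for c
  proof -
    have c: "c \<in> comparisons X" "inj_on g c" using that by (auto simp: cross_comparisons_def)
    obtain a b where ab: "c = {a, b}" "a \<noteq> b" "a \<in> X" "b \<in> X"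
      using comparisons_cases[OF c(1)] .
    then have "g a < v" "g b < v" "g a \<noteq> g b" using groups c(2) by auto
    from joined[OF this] show ?thesis using ab by simp
  qed
  define \<rho> where "\<rho> c = (THE i. i < m \<and> (\<forall>a\<in>c. B i (g a)))" for c
  have \<rho>: "\<rho> c < m \<and> (\<forall>a\<in>c. B (\<rho> c) (g a))" if "c \<in> cross_comparisons X g" for c
    unfolding \<rho>_def by (rule theI'[OF ex1[OF that]])
  have "card {c \<in> cross_comparisons X g. \<rho> c = i} = cross_load" if i: "i < m" for i
  proof -
    let ?J = "{j. j < v \<and> B i j}"
    let ?Y = "{a \<in> X. B i (g a)}"
    let ?U = "\<Union>j\<in>?J. intra_comparisons X g j"
    \<comment> \<open>By uniqueness, block i receives exactly the cross comparisons whose items it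
      holds.\<close>
    have "\<rho> c = i \<longleftrightarrow> (\<forall>a\<in>c. B i (g a))" if "c \<in> cross_comparisons X g" for c
      using \<rho>[OF that] ex1[OF that] i by metis
    then have "{c \<in> cross_comparisons X g. \<rho> c = i} =
        {c \<in> cross_comparisons X g. \<forall>a\<in>c. B i (g a)}"
      by blast
    also have "\<dots> = cross_comparisons ?Y g"
      by (auto simp: cross_comparisons_def comparisons_def)
    also have "cross_comparisons ?Y g = comparisons ?Y - ?U"
    proof -
      \<comment> \<open>A block holds every group at its points entirely, so no comparison inside
        such a group is lost in passing to \<open>?Y\<close>.\<close>
      have "intra_comparisons ?Y g j = intra_comparisons X g j" if "j \<in> ?J" for j
        using that by (auto simp: intra_comparisons_def intro!: arg_cong[where f = comparisons])
      then have "(\<Union>j\<in>?J. intra_comparisons ?Y g j) = ?U" by simp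
      moreover have "g ` ?Y \<subseteq> ?J" using groups by auto
      ultimately show ?thesis
        using comparisons_split[of g ?Y ?J] cross_intra_disjoint[of ?Y g] by blast
    qed
    also have "card \<dots> = card (comparisons ?Y) - card ?U"
    proof (rule card_Diff_subset)
      show "?U \<subseteq> comparisons ?Y"
        by (auto simp: intra_comparisons_def comparisons_def)
    qed (simp add: finite_intra)
    also have "\<dots> = cross_load"
      using card_Union_intra[of ?J] block_size[OF i] card_block_items[OF i] finite_X
      by (simp add: cross_load_def card_comparisons subset_iff)
    finally show ?thesis .
  qed
  with \<rho> show ?thesis by blast
qed

text \<open>Modulo m only the comparisons inside groups remain, which is how divisibility of the
  total becomes usable.\<close>

lemma card_all_comparisons: "card (comparisons X) = m * cross_load + v * (t choose 2)"
proof -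
  obtain \<rho> where \<rho>: "\<forall>c\<in>cross_comparisons X g. \<rho> c < m"
    "\<forall>i<m. card {c \<in> cross_comparisons X g. \<rho> c = i} = cross_load"
    using cross_schedule by blast
  let ?C = "\<lambda>i. {c \<in> cross_comparisons X g. \<rho> c = i}"
  have "cross_comparisons X g = (\<Union>i\<in>{..<m}. ?C i)"
    using \<rho> by auto
  moreover have "card (\<Union>i\<in>{..<m}. ?C i) = (\<Sum>i<m. card (?C i))"
    by (intro card_UN_disjoint) (auto simp: finite_cross)
  ultimately have "card (cross_comparisons X g) = m * cross_load"
    using \<rho>(2) by simp
  moreover have "card (comparisons X) =
      card (cross_comparisons X g) + card (\<Union>j\<in>{..<v}. intra_comparisons X g j)"
    unfolding comparisons_split[OF groups] using cross_intra_disjoint[of X g]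
    by (intro card_Un_disjoint) (auto simp: finite_cross finite_intra)
  ultimately show ?thesis
    using card_Union_intra[of "{..<v}"] by simp
qed

text \<open>Cross loads are equal already, so it suffices to give every block the same load w from
  inside the groups; \<open>\<tau> j\<close> schedules the comparisons inside group j.\<close>

lemma balanced_schedule:
  assumes \<tau>: "\<And>j c. \<lbrakk>j < v; c \<in> intra_comparisons X g j\<rbrakk> \<Longrightarrow> \<tau> j c < m \<and> B (\<tau> j c) j"
    and load: "\<And>i. i < m \<Longrightarrow> (\<Sum>j<v. card {c \<in> intra_comparisons X g j. \<tau> j c = i}) = w"
  shows "\<exists>\<sigma>. (\<forall>c\<in>comparisons X. \<sigma> c < m \<and> (\<forall>a\<in>c. B (\<sigma> c) (g a))) \<and> load_balanced m X \<sigma>"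
proof -
  obtain \<rho> where \<rho>: "\<And>c. c\<in>cross_comparisons X g \<Longrightarrow> \<rho> c < m \<and> (\<forall>a\<in>c. B (\<rho> c) (g a))"
    "\<And>i. i < m \<Longrightarrow> card {c \<in> cross_comparisons X g. \<rho> c = i} = cross_load"
    using cross_schedule by blast
  \<comment> \<open>Any item of c serves to find its group, since outside the cross comparisons both
    items share one.\<close>
  define \<sigma> where "\<sigma> c = (if c \<in> cross_comparisons X g then \<rho> c else \<tau> (g (SOME a. a \<in> c)) c)" for c
  have \<sigma>_cross: "\<sigma> c = \<rho> c" if "c \<in> cross_comparisons X g" for c
    using that by (simp add: \<sigma>_def)
  have group: "g a = j" if "c \<in> intra_comparisons X g j" "a \<in> c" for a c j
    using that by (auto simp: intra_comparisons_def comparisons_def)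
  have \<sigma>_intra: "\<sigma> c = \<tau> j c" if c: "c \<in> intra_comparisons X g j" for j c
  proof -
    have "c \<noteq> {}" using c by (auto simp: intra_comparisons_def comparisons_def)
    then have "g (SOME a. a \<in> c) = j" using group[OF c] by (simp add: some_in_eq)
    moreover have "c \<notin> cross_comparisons X g" using c cross_intra_disjoint[of X g j] by blast
    ultimately show ?thesis by (simp add: \<sigma>_def)
  qed
  have "\<sigma> c < m \<and> (\<forall>a\<in>c. B (\<sigma> c) (g a))" if "c \<in> comparisons X" for c
  proof -
    consider "c \<in> cross_comparisons X g" | j where "j < v" "c \<in> intra_comparisons X g j"
      using \<open>c \<in> comparisons X\<close> comparisons_split[OF groups] by auto
    then show ?thesis
      using \<rho>(1) \<tau> \<sigma>_cross \<sigma>_intra group by cases metis+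
  qed
  moreover have "machine_load X \<sigma> i = cross_load + w" if i: "i < m" for i
  proof -
    let ?C = "{c \<in> cross_comparisons X g. \<rho> c = i}"
    let ?I = "\<lambda>j. {c \<in> intra_comparisons X g j. \<tau> j c = i}"
    have "{c \<in> comparisons X. \<sigma> c = i} = ?C \<union> (\<Union>j\<in>{..<v}. ?I j)"
      using comparisons_split[OF groups] \<sigma>_cross \<sigma>_intra by auto
    moreover have "card (?C \<union> (\<Union>j\<in>{..<v}. ?I j)) = card ?C + card (\<Union>j\<in>{..<v}. ?I j)"
      using cross_intra_disjoint[of X g]
      by (intro card_Un_disjoint) (auto simp: finite_cross finite_intra)
    moreover have "card (\<Union>j\<in>{..<v}. ?I j) = (\<Sum>j<v. card (?I j))"
      using intra_comparisons_disjoint[of _ _ X g]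
      by (intro card_UN_disjoint) (simp_all add: finite_intra, blast)
    ultimately show ?thesis
      using \<rho>(2)[OF i] load[OF i] by (simp add: machine_load_def)
  qed
  ultimately show ?thesis by (intro exI[of _ \<sigma>]) (simp add: load_balanced_def)
qed

text \<open>Each block takes all comparisons inside the one point matched to it.\<close>

lemma balanced_schedule_matching:
  assumes "bij_betw f {..<v} {..<m}" "\<And>j. j < v \<Longrightarrow> B (f j) j"
  shows "\<exists>\<sigma>. (\<forall>c\<in>comparisons X. \<sigma> c < m \<and> (\<forall>a\<in>c. B (\<sigma> c) (g a))) \<and> load_balanced m X \<sigma>"
proof (rule balanced_schedule[where \<tau> = "\<lambda>j c. f j"])
  fix i assume "i < m"
  then obtain k where k: "k < v" "f k = i"
    using assms(1) by (metis bij_betw_imp_surj_on image_iff lessThan_iff)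
  have "f j = i \<longleftrightarrow> j = k" if "j < v" for j
    using assms(1) k that by (metis bij_betw_def inj_onD lessThan_iff)
  then have "(\<Sum>j<v. card {c \<in> intra_comparisons X g j. f j = i})
      = (\<Sum>j<v. if j = k then t choose 2 else 0)"
    by (intro sum.cong) (auto simp: card_intra)
  then show "(\<Sum>j<v. card {c \<in> intra_comparisons X g j. f j = i}) = t choose 2"
    using k by simp
qed (use assms in \<open>auto simp: bij_betw_def\<close>)

text \<open>Each point hands q of its comparisons to each of its r blocks, so a block collects q
  from each of its \<kappa> points.\<close>

lemma balanced_schedule_even:
  assumes "t choose 2 = r * q"
  shows "\<exists>\<sigma>. (\<forall>c\<in>comparisons X. \<sigma> c < m \<and> (\<forall>a\<in>c. B (\<sigma> c) (g a))) \<and> load_balanced m X \<sigma>"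
proof -
  have "\<forall>j\<in>{..<v}. \<exists>h. h ` intra_comparisons X g j \<subseteq> {i. i < m \<and> B i j} \<and>
      (\<forall>i\<in>{i. i < m \<and> B i j}. card {c \<in> intra_comparisons X g j. h c = i} = q)"
    using assms by (intro ballI exists_equipartition) (auto simp: finite_intra card_intra replication)
  from bchoice[OF this] obtain \<tau> where "\<forall>j\<in>{..<v}.
      \<tau> j ` intra_comparisons X g j \<subseteq> {i. i < m \<and> B i j} \<and>
      (\<forall>i\<in>{i. i < m \<and> B i j}. card {c \<in> intra_comparisons X g j. \<tau> j c = i} = q)"
    by blast
  then have \<tau>: "\<And>j. j < v \<Longrightarrow> \<tau> j ` intra_comparisons X g j \<subseteq> {i. i < m \<and> B i j}"
    "\<And>i j. \<lbrakk>j < v; i < m; B i j\<rbrakk> \<Longrightarrow> card {c \<in> intra_comparisons X g j. \<tau> j c = i} = q"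
    by auto
  show ?thesis
  proof (rule balanced_schedule[where \<tau> = \<tau>])
    fix i assume i: "i < m"
    have none: "{c \<in> intra_comparisons X g j. \<tau> j c = i} = {}" if "j < v" "\<not> B i j" for j
      using \<tau>(1)[OF that(1)] that(2) by auto
    have "(\<Sum>j<v. card {c \<in> intra_comparisons X g j. \<tau> j c = i})
        = (\<Sum>j<v. if B i j then q else 0)"
      by (intro sum.cong) (auto simp: \<tau>(2) i none)
    also have "\<dots> = \<kappa> * q"
      using block_size[OF i] by (simp add: sum.If_cases Int_def)
    finally show "(\<Sum>j<v. card {c \<in> intra_comparisons X g j. \<tau> j c = i}) = \<kappa> * q" .
  qed (use \<tau>(1) in auto)
qed

end

section \<open>Distributions derived from planes\<close>

lemma card_nth_filter:
  assumes "distinct xs"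
  shows "card {i. i < length xs \<and> Q (xs ! i)} = card {x \<in> set xs. Q x}"
  using distinct_card[OF distinct_filter[OF assms, of Q]] by (simp add: length_filter_conv_card)

text \<open>Distinctness of the lists makes positions and elements correspond, so the axioms shared
  by both kinds of planes carry over to indices.\<close>

lemma incidence_block_design:
  assumes "distinct ls" "distinct ps"
    and "\<And>p q. \<lbrakk>p \<in> set ps; q \<in> set ps; p \<noteq> q\<rbrakk> \<Longrightarrow> \<exists>!l. l \<in> set ls \<and> I p l \<and> I q l"
    and "\<And>l. l \<in> set ls \<Longrightarrow> card {p \<in> set ps. I p l} = \<kappa>"
    and "\<And>p. p \<in> set ps \<Longrightarrow> card {l \<in> set ls. I p l} = r"
  shows "block_design (\<lambda>i j. I (ps ! j) (ls ! i)) (length ls) (length ps) \<kappa> r"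
proof
  fix j k assume jk: "j < length ps" "k < length ps" "j \<noteq> k"
  then have "\<exists>!l. l \<in> set ls \<and> I (ps ! j) l \<and> I (ps ! k) l"
    using assms(2,3) by (simp add: nth_eq_iff_index_eq)
  then show "\<exists>!i. i < length ls \<and> I (ps ! j) (ls ! i) \<and> I (ps ! k) (ls ! i)"
    using assms(1) by (metis in_set_conv_nth nth_eq_iff_index_eq)
next
  fix i assume "i < length ls"
  then show "card {j. j < length ps \<and> I (ps ! j) (ls ! i)} = \<kappa>"
    using card_nth_filter[OF assms(2), of "\<lambda>p. I p (ls ! i)"] assms(4) by simp
next
  fix j assume "j < length ps"
  then show "card {i. i < length ls \<and> I (ps ! j) (ls ! i)} = r"
    using card_nth_filter[OF assms(1), of "I (ps ! j)"] assms(5) by simp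
qed

text \<open>Off the diagonal, D^T D is nonzero because two points are joined; on it, because each
  point lies on r > 0 blocks. All rows of D have sum \<kappa>, so every machine stores
  \<kappa>/v.\<close>

lemma (in block_design)
  assumes D: "D = mat m v (\<lambda>(i, j). if B i j then 1 else 0 :: real)"
    and s: "s = vec v (\<lambda>_. 1 / real v)" and "0 < v" "0 < r"
  shows uniform_ATAC_distribution: "ATAC_distribution m D s"
    and uniform_storage_limit: "0 < m \<Longrightarrow> storage_limit D s = real \<kappa> / real v"
proof -
  have "(transpose_mat D * D) $$ (j, k) \<noteq> 0" if jk: "j < v" "k < v" for j k
  proof -
    obtain i where i: "i < m" "B i j" "B i k"
    proof (cases "j = k")
      case True
      have "0 < card {i. i < m \<and> B i j}"
        using replication \<open>j < v\<close> \<open>0 < r\<close> by simp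
      then obtain i where "i < m" "B i j"
        by (auto simp: card_gt_0_iff)
      with True show ?thesis by (intro that) auto
    next
      case False
      then show ?thesis using joined[of j k] jk that by blast
    qed
    have "(transpose_mat D * D) $$ (j, k) = (\<Sum>i = 0..<m. D $$ (i, j) * D $$ (i, k))"
      using that by (simp add: D scalar_prod_def)
    also have "\<dots> > 0"
      by (rule sum_pos2[of _ i]) (use i that in \<open>auto simp: D\<close>)
    finally show ?thesis by simp
  qed
  moreover have "data_distribution m D s"
    unfolding data_distribution_def using \<open>0 < v\<close>
    by (intro exI[of _ v]) (auto simp: D s elements_mat_def split: if_splits)
  ultimately show "ATAC_distribution m D s"
    by (simp add: ATAC_distribution_def D)
  have "(D *\<^sub>v s) $ i = real \<kappa> / real v" if "i < m" for i
  proof -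
    have "(D *\<^sub>v s) $ i = (\<Sum>j\<in>{0..<v}. of_bool (B i j) * (1 / real v))"
      using that by (simp add: D s scalar_prod_def of_bool_def)
    also have "\<dots> = real (card ({0..<v} \<inter> {j. B i j})) / real v"
      by (simp only: sum_distrib_right[symmetric] sum_of_bool_eq finite_atLeastLessThan) simp
    also have "{0..<v} \<inter> {j. B i j} = {j. j < v \<and> B i j}" by auto
    finally show ?thesis using block_size[OF that] by simp
  qed
  moreover have "dim_row D = m" by (simp add: D)
  ultimately show "storage_limit D s = real \<kappa> / real v" if "0 < m"
    unfolding storage_limit_def using that
    by (subst image_cong[where g = "\<lambda>_. real \<kappa> / real v"]) (auto simp: image_constant_conv)
qed

lemma storage_limit_eq_L_min:
  assumes "ATAC_distribution m D s" "storage_limit D s = real (n + 1) / real m"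
    and "0 < m" "n * (n + 1) \<le> m"
  shows "storage_limit D s = L_min m"
  unfolding L_min_def
proof (rule cInf_eq_minimum[symmetric])
  show "storage_limit D s \<in> {storage_limit D s |D s. ATAC_distribution m D s}"
    using assms(1) by blast
  fix y assume "y \<in> {storage_limit D s |D s. ATAC_distribution m D s}"
  then show "storage_limit D s \<le> y"
    unfolding assms(2) using storage_limit_lower_bound[OF _ assms(3,4)] by blast
qed

text \<open>Divisibility of the number of comparisons by m is the condition under which equal
  integer loads can exist at all.\<close>

theorem corollary15:
  fixes n m :: nat
    and P :: "'p set" and L :: "'l set" and I :: "'p \<Rightarrow> 'l \<Rightarrow> bool"
    and D :: "real mat" and s :: "real vec"
  assumes "finite_projective_plane n P L I \<and> m = n\<^sup>2 + n + 1 \<or>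
           finite_affine_plane n P L I \<and> m = n\<^sup>2 + n"
    and "derived_distribution P L I D s"
  shows "ATAC_distribution m D s \<and>
         (\<forall>(X :: 'd set) g. grouped_data s X g \<and> m dvd card (comparisons X) \<longrightarrow>
            (\<exists>\<sigma>. ATAC_schedule D X g \<sigma> \<and> load_balanced m X \<sigma>)) \<and>
         storage_limit D s = L_min m"
proof -
  obtain ls ps where ls: "distinct ls" "set ls = L" and ps: "distinct ps" "set ps = P"
    and D: "D = incidence_mat I ls ps" and s: "s = vec (card P) (\<lambda>_. 1 / real (card P))"
    using assms(2) unfolding derived_distribution_def by blast
  define B where "B i j = I (ps ! j) (ls ! i)" for i j
  define v where "v = card P"
  obtain \<kappa> where plane: "m = v \<and> \<kappa> = n + 1 \<and> v = n\<^sup>2 + n + 1 \<or> 0 < n \<and> m = n\<^sup>2 + n \<and> \<kappa> = n \<and> v = n\<^sup>2"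
    and m: "card L = m"
    and joined: "\<And>p q. \<lbrakk>p \<in> P; q \<in> P; p \<noteq> q\<rbrakk> \<Longrightarrow> \<exists>!l. l \<in> L \<and> I p l \<and> I q l"
    and line: "\<And>l. l \<in> L \<Longrightarrow> card {p \<in> P. I p l} = \<kappa>"
    and point: "\<And>p. p \<in> P \<Longrightarrow> card {l \<in> L. I p l} = n + 1"
    using assms(1)
  proof
    assume "finite_projective_plane n P L I \<and> m = n\<^sup>2 + n + 1"
    then show ?thesis
      by (intro that[of "n + 1"]) (simp_all add: finite_projective_plane_def v_def)
  next
    assume "finite_affine_plane n P L I \<and> m = n\<^sup>2 + n"
    then show ?thesis
      by (intro that[of n]) (simp_all add: finite_affine_plane_def v_def)
  qed
  have len: "length ls = m" "length ps = v"
    using ls ps m distinct_card by (fastforce simp: v_def)+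
  interpret block_design B m v \<kappa> "n + 1"
    using incidence_block_design[of ls ps I \<kappa> "n + 1"] joined line point ls ps
    unfolding B_def by (simp add: len)
  have D': "D = mat m v (\<lambda>(i, j). if B i j then 1 else 0)"
    by (simp add: D incidence_mat_def len B_def)
  have s': "s = vec v (\<lambda>_. 1 / real v)"
    by (simp add: s v_def)
  have pos: "0 < v" "0 < m" and m_ge: "n * (n + 1) \<le> m"
    using plane by (auto simp: power2_eq_square)
  have ATAC: "ATAC_distribution m D s"
    using uniform_ATAC_distribution[OF D' s'] pos by simp
  moreover have "storage_limit D s = L_min m"
  proof (rule storage_limit_eq_L_min[OF ATAC _ pos(2) m_ge])
    \<comment> \<open>For a projective plane v = m and \<kappa> = n+1; for an affine one n/n^2 =
      (n+1)/(n(n+1)).\<close>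
    have "real \<kappa> / real v = real (n + 1) / real m"
      using plane by (auto simp: field_simps power2_eq_square add_nonneg_eq_0_iff)
    then show "storage_limit D s = real (n + 1) / real m"
      using uniform_storage_limit[OF D' s'] pos by simp
  qed
  moreover have "\<exists>\<sigma>. ATAC_schedule D X g \<sigma> \<and> load_balanced m X \<sigma>"
    if X: "grouped_data s X g" and dvd: "m dvd card (comparisons X)" for X :: "'d set" and g
  proof -
    \<comment> \<open>Uniform s makes all groups equally large, so group 0, which exists since v >
      0, supplies the common size.\<close>
    define t where "t = card {a \<in> X. g a = 0}"
    have size: "real (card {a \<in> X. g a = j}) = real (card X) / real v" if "j < v" for j
      using X that by (simp add: grouped_data_def s')
    have size_t: "card {a \<in> X. g a = j} = t" if "j < v" for j
      using size[OF that] size[OF pos(1)] by (simp add: t_def)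
    have gX: "finite X" "g ` X \<subseteq> {..<v}"
      using X by (auto simp: grouped_data_def s')
    interpret grouped_design B m v \<kappa> "n + 1" X g t
      by unfold_locales (use gX size_t in auto)
    have "\<exists>\<sigma>. (\<forall>c\<in>comparisons X. \<sigma> c < m \<and> (\<forall>a\<in>c. B (\<sigma> c) (g a))) \<and> load_balanced m X \<sigma>"
      using plane
    proof
      assume "m = v \<and> \<kappa> = n + 1 \<and> v = n\<^sup>2 + n + 1"
      then obtain f where "bij_betw f {..<v} {..<m}" "\<forall>j<v. B (f j) j"
        using exists_matching by auto
      then show ?thesis by (intro balanced_schedule_matching) auto
    next
      assume affine: "0 < n \<and> m = n\<^sup>2 + n \<and> \<kappa> = n \<and> v = n\<^sup>2"
      \<comment> \<open>As m = n(n+1) divides n^2 times the binomial coefficient, cancelling n > 0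
        and using that n and n+1 are coprime leaves n+1 as a divisor of the coefficient.\<close>
      have "m dvd v * (t choose 2)"
        using dvd by (simp add: card_all_comparisons dvd_add_right_iff)
      then have "n * (n + 1) dvd n * (n * (t choose 2))"
        using affine by (simp add: power2_eq_square algebra_simps)
      then have "n + 1 dvd n * (t choose 2)"
        using affine by (simp only: nat_mult_dvd_cancel_disj) simp
      then have "n + 1 dvd t choose 2"
        by (simp add: coprime_dvd_mult_right_iff)
      then show ?thesis by (auto elim!: dvdE intro: balanced_schedule_even)
    qed
    then obtain \<sigma> where \<sigma>: "\<And>c. c \<in> comparisons X \<Longrightarrow> \<sigma> c < m \<and> (\<forall>a\<in>c. B (\<sigma> c) (g a))"
      "load_balanced m X \<sigma>"
      by blast
    have "ATAC_schedule D X g \<sigma>"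
      unfolding ATAC_schedule_def
    proof (intro ballI conjI)
      fix c a assume c: "c \<in> comparisons X" "a \<in> c"
      then have "g a < v" using gX by (auto simp: comparisons_def)
      then show "D $$ (\<sigma> c, g a) = 1" using \<sigma>(1)[OF c(1)] c(2) by (simp add: D')
    qed (use \<sigma> in \<open>simp add: D'\<close>)
    with \<sigma>(2) show ?thesis by blast
  qed
  ultimately show ?thesis by blast
qed

end
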